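(* Let $(X,d)$ be a complete metric space and let $u\in BC(\mathbb{R}^+,X)$. The following statements are equivalent. (i) There exist $t_0\ge 0$ and $\omega>0$ such that $u$ is $\omega$-periodic on $[t_0,+\infty)$, i.e. $u(t+\omega)=u(t)$ for all $t\ge t_0$. (ii) The set $\{T^+_\tau u : \tau\ge 0\}$ is a compact subset of $(BC(\mathbb{R}^+,X),d_{\infty,+})$.
   Context: $\mathbb{R}^+=[0,+\infty)$. For a metric space $(X,d)$, $BC(\mathbb{R}^+,X)$ is the space of all bounded continuous functions from $\mathbb{R}^+$ to $X$, with the metric $d_{\infty,+}(u,v)=\sup_{t\ge 0}d(u(t),v(t))$. For $\tau\ge 0$ and $u\in BC(\mathbb{R}^+,X)$, the translate $T^+_\tau u\in BC(\mathbb{R}^+,X)$ is $T^+_\tau u(t)=u(t+\tau)$, $t\ge 0$. *)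

theory Defs
  imports "HOL-Analysis.Analysis"
begin

(* Elements of the space of bounded continuous functions [0,+oo) -> X are, following the library's
   funspace, total functions on the reals that are undefined outside {0..}. *)
definition BC_plus :: "'a metric \<Rightarrow> (real \<Rightarrow> 'a) metric"
  where "BC_plus m = cfunspace (top_of_set {0..}) m"

(* The restriction keeps the translate extensional on {0..}; without it u (t + \<tau>) would be
   visible at t < 0. *)
definition translate_plus :: "real \<Rightarrow> (real \<Rightarrow> 'a) \<Rightarrow> real \<Rightarrow> 'a"
  where "translate_plus \<tau> u = (\<lambda>t\<in>{0..}. u (t + \<tau>))"

lemma mspace_BC_plus:
  "u \<in> mspace (BC_plus m) \<longleftrightarrow>
     u \<in> extensional {0..} \<and> continuous_map (top_of_set {0..}) (mtopology_of m) u \<and>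
     Metric_space.mbounded (mspace m) (mdist m) (u ` {0..})"
  unfolding BC_plus_def
  by (auto simp: Metric_space.fspace_def continuous_map_def)

lemma mdist_BC_plus:
  assumes "u \<in> mspace (BC_plus m)" "v \<in> mspace (BC_plus m)"
  shows "mdist (BC_plus m) u v = (SUP t\<in>{0..}. mdist m (u t) (v t))"
  using assms unfolding BC_plus_def
  by (simp add: Metric_space.fdist_def cfunspace_def)

lemma translate_plus_in_BC_plus:
  assumes u: "u \<in> mspace (BC_plus m)" and \<tau>: "\<tau> \<ge> 0"
  shows "translate_plus \<tau> u \<in> mspace (BC_plus m)"
proof -
  have "continuous_map (top_of_set {0..}) (top_of_set {0..}) (\<lambda>t::real. t + \<tau>)"
    using \<tau> by (auto intro!: continuous_intros)
  then have "continuous_map (top_of_set {0..}) (mtopology_of m) (u \<circ> (\<lambda>t. t + \<tau>))"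
    by (rule continuous_map_compose) (use u mspace_BC_plus in blast)
  then have "continuous_map (top_of_set {0..}) (mtopology_of m) (translate_plus \<tau> u)"
    by (rule continuous_map_eq) (simp add: translate_plus_def)
  moreover have "translate_plus \<tau> u ` {0..} \<subseteq> u ` {0..}"
    using \<tau> by (auto simp: translate_plus_def)
  ultimately show ?thesis
    using u Metric_space.mbounded_subset[OF Metric_space_mspace_mdist]
    by (fastforce simp: mspace_BC_plus translate_plus_def)
qed

end

theory Submission
  imports Defs
begin

text \<open>
  If \<open>u\<close> repeats with period \<open>\<omega>\<close> from time \<open>t0\<close> on, every translate agrees with one by a time in
  \<open>[0, t0 + \<omega>]\<close>. Moreover \<open>u\<close> is uniformly continuous, which says exactly that translation
  \<open>\<tau> \<mapsto> T\<^sub>\<tau> u\<close> is uniformly continuous into the sup metric. The orbit is thus a continuous image of a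
  compact interval (\<open>eventually_periodic_imp_compact_orbit\<close>).

  Conversely, let the orbit be compact. An equality \<open>T\<^sub>\<sigma> u = T\<^sub>\<tau> u\<close> with \<open>\<sigma> < \<tau>\<close> means precisely that
  \<open>u\<close> has period \<open>\<tau> - \<sigma>\<close> on \<open>[\<sigma>, \<infinity>)\<close>, so it is enough that the orbit meets itself. Let \<open>\<Omega>\<close> be the
  limit set, the intersection over \<open>n\<close> of the closures of the tails \<open>{T\<^sub>s u | s \<ge> n}\<close>. It is nonempty and
  compact, and the orbit, being closed, contains it. Thus \<open>\<Omega>\<close> is the union of its intersections
  with the arcs \<open>{T\<^sub>s u | 0 \<le> s \<le> n}\<close>, which are closed
  (\<open>closedin_translate_plus_interval\<close>). By Baire's theorem one arc contains a nonempty relatively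
  open part \<open>U\<close> of \<open>\<Omega>\<close>. A point of \<open>U\<close> is a translate \<open>T\<^sub>\<rho> u\<close> in \<open>\<Omega>\<close>; from time \<open>\<rho>\<close> on the orbit
  stays in \<open>\<Omega>\<close> (\<open>omega_limit_translate_plus\<close>) and, by the definition of \<open>\<Omega>\<close>, it comes
  arbitrarily close to \<open>T\<^sub>\<rho> u\<close> at arbitrarily late times. At a time \<open>\<tau> > n\<close> it is therefore in \<open>U\<close>, hence
  on the arc traversed up to time \<open>n\<close>: the orbit has met itself.

  The limit set cannot be replaced by the whole orbit in this argument: the initial
  transient can have interior in the orbit although the orbit never returns to it.
\<close>

section \<open>Translates in the space of bounded continuous functions\<close>

lemma mdist_BC_plus_le_iff:
  assumes "u \<in> mspace (BC_plus m)" "v \<in> mspace (BC_plus m)"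
  shows "mdist (BC_plus m) u v \<le> a \<longleftrightarrow> (\<forall>t\<ge>0. mdist m (u t) (v t) \<le> a)"
  using assms cfunspace_mdist_le[of u "top_of_set {0..}" m v a]
  unfolding BC_plus_def by auto

lemma BC_plus_in_mspace:
  assumes "u \<in> mspace (BC_plus m)" "t \<ge> 0"
  shows "u t \<in> mspace m"
  using assms by (auto simp: mspace_BC_plus continuous_map_def)

text \<open>A common shift by \<open>h\<close> restricts the supremum that defines the distance to \<open>[h, \<infinity>)\<close>.\<close>

lemma mdist_translate_plus_shift_le:
  assumes u: "u \<in> mspace (BC_plus m)" and "\<sigma> \<ge> 0" "\<tau> \<ge> 0" "h \<ge> 0"
  shows "mdist (BC_plus m) (translate_plus (\<sigma> + h) u) (translate_plus (\<tau> + h) u)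
           \<le> mdist (BC_plus m) (translate_plus \<sigma> u) (translate_plus \<tau> u)"
proof -
  have "mdist m (u (s + \<sigma>)) (u (s + \<tau>))
          \<le> mdist (BC_plus m) (translate_plus \<sigma> u) (translate_plus \<tau> u)" if "s \<ge> 0" for s
    using mdist_BC_plus_le_iff[OF translate_plus_in_BC_plus[OF u \<open>\<sigma> \<ge> 0\<close>]
        translate_plus_in_BC_plus[OF u \<open>\<tau> \<ge> 0\<close>]] that
    by (force simp: translate_plus_def)
  note le = this
  show ?thesis
  proof (subst mdist_BC_plus_le_iff)
    show "\<forall>t\<ge>0. mdist m (translate_plus (\<sigma> + h) u t) (translate_plus (\<tau> + h) u t)
            \<le> mdist (BC_plus m) (translate_plus \<sigma> u) (translate_plus \<tau> u)"
      using le[of "t + h" for t] \<open>h \<ge> 0\<close>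
      by (simp add: translate_plus_def[of "_ + h"] add_ac)
  qed (use assms in \<open>simp_all add: translate_plus_in_BC_plus\<close>)
qed

lemma translate_plus_eq_imp_periodic:
  assumes "translate_plus \<sigma> u = translate_plus \<tau> u" and "t \<ge> \<sigma>"
  shows "u (t + (\<tau> - \<sigma>)) = u t"
  using fun_cong[OF assms(1), of "t - \<sigma>"] assms(2)
  by (simp add: translate_plus_def algebra_simps)

text \<open>The time interval is compact, so the shifts of a uniformly convergent sequence of translates
  have a convergent subsequence. Along it the translates converge pointwise, by continuity of
  \<open>u\<close>, to the translate by the limit shift, and this must be the uniform limit.\<close>

lemma closedin_translate_plus_interval:
  assumes u: "u \<in> mspace (BC_plus m)" and "a \<ge> 0"
  shows "closedin (mtopology_of (BC_plus m)) ((\<lambda>\<tau>. translate_plus \<tau> u) ` {a..b})"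
proof -
  interpret M: Metric_space "mspace m" "mdist m" by simp
  interpret B: Metric_space "mspace (BC_plus m)" "mdist (BC_plus m)" by simp
  let ?T = "\<lambda>\<tau>. translate_plus \<tau> u"
  have "v \<in> ?T ` {a..b}"
    if \<sigma>: "range \<sigma> \<subseteq> ?T ` {a..b}" and lim: "limitin B.mtopology \<sigma> v sequentially" for \<sigma> v
  proof -
    have v: "v \<in> mspace (BC_plus m)"
      using lim B.limitin_mspace by blast
    have "\<forall>n. \<exists>s. s \<in> {a..b} \<and> \<sigma> n = ?T s"
      using \<sigma> by blast
    then obtain s where s: "\<And>n. s n \<in> {a..b}" "\<And>n. \<sigma> n = ?T (s n)"
      by metis
    have "seq_compact {a..b}"
      using compact_Icc compact_eq_seq_compact_metric by blast
    then obtain l r where l: "l \<in> {a..b}" and r: "strict_mono r" and sr: "(s \<circ> r) \<longlonglongrightarrow> l"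
      using s(1) by (meson seq_compactE)
    have "v t = ?T l t" for t
    proof (cases "t \<ge> 0")
      case False
      then show ?thesis
        using v by (simp add: mspace_BC_plus translate_plus_def extensional_def)
    next
      case t: True
      have cont: "continuous_map (top_of_set {0..}) M.mtopology u"
        using u by (simp add: mspace_BC_plus mtopology_of_def)
      have "(\<lambda>n. t + (s \<circ> r) n) \<longlonglongrightarrow> t + l"
        using sr by (intro tendsto_intros)
      then have "limitin (top_of_set {0..}) (\<lambda>n. t + (s \<circ> r) n) (t + l) sequentially"
        unfolding limitin_subtopology limitin_canonical_iff
        using s(1) l t \<open>a \<ge> 0\<close>
        by (auto intro!: always_eventually add_nonneg_nonneg intro: order_trans)
      then have 1: "limitin M.mtopology (u \<circ> (\<lambda>n. t + (s \<circ> r) n)) (u (t + l)) sequentially"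
        by (rule continuous_map_limit[OF cont])
      have "limitin B.mtopology (\<sigma> \<circ> r) v sequentially"
        by (rule limitin_subsequence[OF r lim])
      then have lim0: "(\<lambda>n. mdist (BC_plus m) ((\<sigma> \<circ> r) n) v) \<longlonglongrightarrow> 0"
        by (simp add: B.limitin_metric_dist_null)
      have *: "mdist m (u (t + (s \<circ> r) n)) (v t) \<le> mdist (BC_plus m) ((\<sigma> \<circ> r) n) v" for n
      proof -
        have "?T (s (r n)) \<in> mspace (BC_plus m)"
          using s(1)[of "r n"] \<open>a \<ge> 0\<close> u by (simp add: translate_plus_in_BC_plus)
        from mdist_BC_plus_le_iff[OF this v] t show ?thesis
          by (force simp: s(2) translate_plus_def)
      qed
      have "(\<lambda>n. mdist m (u (t + (s \<circ> r) n)) (v t)) \<longlonglongrightarrow> 0"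
        by (rule tendsto_sandwich[OF _ _ tendsto_const lim0]) (use * in \<open>auto intro: eventuallyI\<close>)
      moreover have "u (t + (s \<circ> r) n) \<in> mspace m" for n
        using s(1)[of "r n"] t \<open>a \<ge> 0\<close> by (intro BC_plus_in_mspace[OF u]) simp
      ultimately have 2: "limitin M.mtopology (u \<circ> (\<lambda>n. t + (s \<circ> r) n)) (v t) sequentially"
        using BC_plus_in_mspace[OF v t] by (simp add: M.limitin_metric_dist_null o_def)
      have "v t = u (t + l)"
        using M.limitin_metric_unique[OF 2 1] by simp
      with t show ?thesis
        by (simp add: translate_plus_def)
    qed
    then show ?thesis
      using l by blast
  qed
  moreover have "?T ` {a..b} \<subseteq> mspace (BC_plus m)"
    using u \<open>a \<ge> 0\<close> by (auto intro: translate_plus_in_BC_plus)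
  ultimately show ?thesis
    unfolding mtopology_of_def B.metric_closedin_iff_sequentially_closed by blast
qed

section \<open>Compactness of the orbit forces eventual periodicity\<close>

text \<open>Translation by \<open>\<tau> - \<sigma>\<close> is nonexpansive and maps each tail of the orbit into itself, so it
  maps limit points of the orbit to limit points: once in the limit set, the orbit stays there.\<close>

lemma omega_limit_translate_plus:
  assumes u: "u \<in> mspace (BC_plus m)" and "0 \<le> \<sigma>" "\<sigma> \<le> \<tau>"
    and \<sigma>: "\<And>n::nat. translate_plus \<sigma> u
            \<in> mtopology_of (BC_plus m) closure_of ((\<lambda>\<tau>. translate_plus \<tau> u) ` {real n..})"
  shows "translate_plus \<tau> u
           \<in> mtopology_of (BC_plus m) closure_of ((\<lambda>\<tau>. translate_plus \<tau> u) ` {real n..})"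
proof -
  interpret B: Metric_space "mspace (BC_plus m)" "mdist (BC_plus m)" by simp
  let ?T = "\<lambda>\<tau>. translate_plus \<tau> u"
  have T: "?T s \<in> mspace (BC_plus m)" if "s \<ge> 0" for s
    using translate_plus_in_BC_plus[OF u that] .
  have "\<exists>y \<in> ?T ` {real n..}. y \<in> B.mball (?T \<tau>) r" if "r > 0" for r
  proof -
    obtain s where s: "s \<ge> real n" "mdist (BC_plus m) (?T \<sigma>) (?T s) < r"
      using \<sigma>[of n] \<open>r > 0\<close> by (fastforce simp: mtopology_of_def B.metric_closure_of)
    have "mdist (BC_plus m) (?T (\<sigma> + (\<tau> - \<sigma>))) (?T (s + (\<tau> - \<sigma>)))
            \<le> mdist (BC_plus m) (?T \<sigma>) (?T s)"
      using assms s by (intro mdist_translate_plus_shift_le) auto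
    then have "mdist (BC_plus m) (?T \<tau>) (?T (s + (\<tau> - \<sigma>))) < r"
      using s(2) by simp
    moreover have "s + (\<tau> - \<sigma>) \<ge> real n"
      using s(1) \<open>\<sigma> \<le> \<tau>\<close> by simp
    ultimately show ?thesis
      using T[of \<tau>] T[of "s + (\<tau> - \<sigma>)"] \<open>0 \<le> \<sigma>\<close> \<open>\<sigma> \<le> \<tau>\<close> by force
  qed
  then show ?thesis
    using T[of \<tau>] \<open>0 \<le> \<sigma>\<close> \<open>\<sigma> \<le> \<tau>\<close> by (simp add: mtopology_of_def B.metric_closure_of)
qed

text \<open>This is the Baire category argument: the limit set is covered by countably many closed arcs, one
  of them contains a relatively open piece of it, and the orbit enters that piece again after it
  has completed the arc.\<close>

lemma compact_orbit_imp_translate_plus_eq: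
  assumes u: "u \<in> mspace (BC_plus m)"
    and K: "compactin (mtopology_of (BC_plus m)) {translate_plus \<tau> u |\<tau>. \<tau> \<ge> 0}"
  obtains \<sigma> \<tau> where "0 \<le> \<sigma>" "\<sigma> < \<tau>" "translate_plus \<sigma> u = translate_plus \<tau> u"
proof -
  define X where "X = mtopology_of (BC_plus m)"
  define K where "K = {translate_plus \<tau> u |\<tau>. \<tau> \<ge> 0}"
  define T where "T = (\<lambda>\<tau>. translate_plus \<tau> u)"
  define C where "C n = X closure_of (T ` {real n..})" for n
  define \<Omega> where "\<Omega> = (\<Inter>n. C n)"
  have Haus: "Hausdorff_space X"
    unfolding X_def mtopology_of_def by (simp add: Metric_space.Hausdorff_space_mtopology)
  have cK: "compactin X K"
    using K by (simp add: X_def K_def)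
  have closK: "closedin X K"
    using cK Haus compactin_imp_closedin by blast
  have KT: "K = T ` {0..}"
    by (auto simp: K_def T_def)
  have "T ` {real n..} \<subseteq> K" for n
    unfolding KT by (rule image_mono) auto
  then have CK: "C n \<subseteq> K" for n
    unfolding C_def using closK by (simp add: closure_of_minimal)
  have TX: "T ` {real n..} \<subseteq> topspace X" for n
    using translate_plus_in_BC_plus[OF u] by (auto simp: X_def T_def)
  have "(\<Inter>n. C n) \<noteq> {}"
  proof (rule compact_space_imp_nest)
    show "compact_space (subtopology X K)"
      using cK by (rule compact_space_subtopology)
    show "closedin (subtopology X K) (C n)" for n
      using CK by (simp add: C_def closedin_subset_topspace closedin_closure_of)
    show "C n \<noteq> {}" for n
      using closure_of_subset[OF TX[of n]] by (auto simp: C_def)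
    show "decseq C"
      unfolding C_def by (intro decseq_SucI closure_of_mono image_mono) auto
  qed
  then have \<Omega>_ne: "\<Omega> \<noteq> {}"
    by (simp add: \<Omega>_def)
  have \<Omega>K: "\<Omega> \<subseteq> K"
    using CK by (auto simp: \<Omega>_def)
  have clos\<Omega>: "closedin X \<Omega>"
    unfolding \<Omega>_def C_def by (intro closedin_Inter) auto
  then have "compactin X \<Omega>"
    using \<Omega>K cK closed_compactin by blast
  then have comp: "compact_space (subtopology X \<Omega>)"
    by (rule compact_space_subtopology)
  have Haus\<Omega>: "Hausdorff_space (subtopology X \<Omega>)"
    using Haus by (rule Hausdorff_space_subtopology)
  have top: "topspace (subtopology X \<Omega>) = \<Omega>"
    using closedin_subset[OF clos\<Omega>] by auto
  define \<G> where "\<G> = range (\<lambda>n::nat. T ` {0..real n} \<inter> \<Omega>)"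
  have clos: "closedin (subtopology X \<Omega>) G" if "G \<in> \<G>" for G
    using that closedin_translate_plus_interval[OF u order_refl]
    by (auto simp: \<G>_def X_def T_def closedin_subtopology)
  have "\<Union>\<G> = \<Omega>"
  proof -
    have "\<exists>n::nat. x \<in> T ` {0..real n}" if x: "x \<in> \<Omega>" for x
    proof -
      obtain t where "t \<ge> 0" "x = T t"
        using x \<Omega>K KT by blast
      then show ?thesis
        using real_arch_simple[of t] by fastforce
    qed
    then show ?thesis
      by (auto simp: \<G>_def)
  qed
  then have "subtopology X \<Omega> interior_of \<Union>\<G> \<noteq> {}"
    using \<Omega>_ne top interior_of_topspace[of "subtopology X \<Omega>"] by simp
  moreover have "locally_compact_space (subtopology X \<Omega>)" "regular_space (subtopology X \<Omega>)"
    using comp Haus\<Omega> compact_imp_locally_compact_space compact_Hausdorff_imp_regular_space by blast+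
  moreover have "countable \<G>"
    by (simp add: \<G>_def)
  ultimately obtain G where "G \<in> \<G>" "subtopology X \<Omega> interior_of G \<noteq> {}"
    using Baire_category_alt[of "subtopology X \<Omega>" \<G>] clos by blast
  then obtain n p where "p \<in> subtopology X \<Omega> interior_of (T ` {0..real n} \<inter> \<Omega>)"
    by (auto simp: \<G>_def)
  then obtain U where U: "openin X U" "p \<in> U" "p \<in> \<Omega>" "U \<inter> \<Omega> \<subseteq> T ` {0..real n}"
    by (auto simp: interior_of_def openin_subtopology)
  obtain \<rho> where \<rho>: "\<rho> \<ge> 0" "p = T \<rho>"
    using U(3) \<Omega>K KT by blast
  \<comment> \<open>A return time beyond \<open>n\<close> differs from all times on the arc; one beyond \<open>\<rho>\<close> gives a translate
    in the limit set.\<close>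
  obtain N :: nat where N: "real N \<ge> max (real n + 1) \<rho>"
    using real_arch_simple by blast
  have "p \<in> X closure_of (T ` {real N..})"
    using U(3) by (auto simp: \<Omega>_def C_def)
  then obtain \<tau> where \<tau>: "\<tau> \<ge> real N" "T \<tau> \<in> U"
    using U(1,2) by (auto simp: in_closure_of)
  have "T \<rho> \<in> X closure_of (T ` {real k..})" for k
    using U(3) \<rho>(2) by (auto simp: \<Omega>_def C_def)
  moreover have "\<rho> \<le> \<tau>"
    using N \<tau>(1) by simp
  ultimately have "T \<tau> \<in> X closure_of (T ` {real k..})" for k
    using omega_limit_translate_plus[OF u \<rho>(1)] unfolding T_def X_def by blast
  then have "T \<tau> \<in> \<Omega>"
    by (simp add: \<Omega>_def C_def)
  then obtain \<sigma> where \<sigma>: "\<sigma> \<in> {0..real n}" "T \<tau> = T \<sigma>"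
    using U(4) \<tau>(2) by blast
  show thesis
    by (rule that[of \<sigma> \<tau>]) (use \<sigma> \<tau> N in \<open>auto simp: T_def\<close>)
qed

section \<open>Eventually periodic functions have compact orbits\<close>

lemma eventually_periodic_mult:
  fixes u :: "real \<Rightarrow> 'a"
  assumes per: "\<And>t. t \<ge> t0 \<Longrightarrow> u (t + \<omega>) = u t" and "\<omega> > 0" "t \<ge> t0"
  shows "u (t + real n * \<omega>) = u t"
proof (induction n)
  case (Suc n)
  have "t0 \<le> t + real n * \<omega>"
    using \<open>\<omega> > 0\<close> \<open>t \<ge> t0\<close> by (simp add: add_increasing2)
  from per[OF this] Suc show ?case
    by (simp add: algebra_simps)
qed simp

lemma reduce_mod_period:
  fixes t :: real
  assumes "\<omega> > 0" "t \<ge> t0"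
  obtains n :: nat and s where "t = s + real n * \<omega>" "t0 \<le> s" "s < t0 + \<omega>"
proof
  define n where "n = nat \<lfloor>(t - t0) / \<omega>\<rfloor>"
  have "real n = of_int \<lfloor>(t - t0) / \<omega>\<rfloor>"
    using assms by (simp add: n_def)
  then have "real n \<le> (t - t0) / \<omega>" "(t - t0) / \<omega> < real n + 1"
    by linarith+
  then show "t0 \<le> t - real n * \<omega>" "t - real n * \<omega> < t0 + \<omega>"
    using \<open>\<omega> > 0\<close> by (simp_all add: field_simps)
  show "t = t - real n * \<omega> + real n * \<omega>"
    by simp
qed

text \<open>Two points less than one period apart either lie in \<open>[0, t0 + 2 \<omega>]\<close>, where continuity is uniform
  by compactness, or are moved there by a common multiple of the period.\<close>

lemma eventually_periodic_imp_uniformly_continuous: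
  fixes u :: "real \<Rightarrow> 'a"
  assumes u: "continuous_map (top_of_set {0..}) (mtopology_of m) u"
    and per: "\<And>t. t \<ge> t0 \<Longrightarrow> u (t + \<omega>) = u t" and "t0 \<ge> 0" "\<omega> > 0"
  shows "uniformly_continuous_map (submetric euclidean_metric {0..}) m u"
proof -
  let ?I = "{0..t0 + 2 * \<omega>}"
  have "continuous_map (top_of_set ?I) (mtopology_of m) u"
    using continuous_map_from_subtopology_mono[OF u] by auto
  then have "uniformly_continuous_map (submetric euclidean_metric ?I) m u"
    by (intro continuous_imp_uniformly_continuous_map)
      (auto simp: mtopology_of_submetric compact_space_subtopology)
  then have uc: "\<forall>\<epsilon>>0. \<exists>\<delta>>0. \<forall>x\<in>?I. \<forall>y\<in>?I. dist y x < \<delta> \<longrightarrow> mdist m (u y) (u x) < \<epsilon>"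
    by (simp add: uniformly_continuous_map_def)
  have "\<exists>\<delta>>0. \<forall>x\<ge>0. \<forall>y\<ge>0. dist y x < \<delta> \<longrightarrow> mdist m (u y) (u x) < \<epsilon>" if \<epsilon>: "\<epsilon> > 0" for \<epsilon>
  proof -
    obtain \<delta> where \<delta>: "\<delta> > 0" "\<And>x y. \<lbrakk>x \<in> ?I; y \<in> ?I; dist y x < \<delta>\<rbrakk> \<Longrightarrow> mdist m (u y) (u x) < \<epsilon>"
      using uc \<epsilon> by metis
    have ord: "mdist m (u y) (u x) < \<epsilon>"
      if xy: "0 \<le> x" "x \<le> y" "dist y x < min \<delta> \<omega>" for x y
    proof (cases "x \<ge> t0")
      case False
      with xy \<open>\<omega> > 0\<close> show ?thesis
        by (intro \<delta>(2)) (auto simp: dist_real_def)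
    next
      case True
      obtain n s where n: "x = s + real n * \<omega>" "t0 \<le> s" "s < t0 + \<omega>"
        using reduce_mod_period[OF \<open>\<omega> > 0\<close> True] by metis
      define s' where "s' = s + (y - x)"
      have y: "y = s' + real n * \<omega>" "s \<le> s'"
        using n(1) xy by (simp_all add: s'_def)
      have "u x = u s" "u y = u s'"
        using eventually_periodic_mult[of t0 u \<omega>, OF per \<open>\<omega> > 0\<close>] n y by simp_all
      moreover have "mdist m (u s') (u s) < \<epsilon>"
        using xy n \<open>t0 \<ge> 0\<close> \<open>\<omega> > 0\<close> by (intro \<delta>(2)) (auto simp: dist_real_def s'_def)
      ultimately show ?thesis
        by simp
    qed
    have "mdist m (u y) (u x) < \<epsilon>" if "0 \<le> x" "0 \<le> y" "dist y x < min \<delta> \<omega>" for x y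
      using ord[of x y] ord[of y x] that by (cases "x \<le> y") (simp_all add: mdist_commute dist_commute)
    then show ?thesis
      using \<open>\<delta> > 0\<close> \<open>\<omega> > 0\<close> by (intro exI[of _ "min \<delta> \<omega>"]) auto
  qed
  then show ?thesis
    using continuous_map_image_subset_topspace[OF u]
    by (simp add: uniformly_continuous_map_def image_subset_iff_funcset Ball_def)
qed

text \<open>The two points compared, \<open>t + \<sigma>\<close> and \<open>t + \<tau>\<close>, have a distance independent of \<open>t\<close>, so a modulus
  of continuity of \<open>u\<close> is one of translation in the sup metric.\<close>

lemma uniformly_continuous_translate_plus:
  assumes u: "u \<in> mspace (BC_plus m)"
    and uc: "uniformly_continuous_map (submetric euclidean_metric {0..}) m u"
  shows "uniformly_continuous_map (submetric euclidean_metric {0..}) (BC_plus m)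
           (\<lambda>\<tau>. translate_plus \<tau> u)"
proof -
  have uc': "\<forall>\<epsilon>>0. \<exists>\<delta>>0. \<forall>x\<in>{0..}. \<forall>y\<in>{0..}. dist y x < \<delta> \<longrightarrow> mdist m (u y) (u x) < \<epsilon>"
    using uc by (simp add: uniformly_continuous_map_def)
  have "\<exists>\<delta>>0. \<forall>\<sigma>\<ge>0. \<forall>\<tau>\<ge>0. dist \<tau> \<sigma> < \<delta> \<longrightarrow>
          mdist (BC_plus m) (translate_plus \<tau> u) (translate_plus \<sigma> u) < \<epsilon>" if "\<epsilon> > 0" for \<epsilon>
  proof -
    obtain \<delta> where \<delta>: "\<delta> > 0"
      "\<And>x y. \<lbrakk>x \<ge> 0; y \<ge> 0; dist y x < \<delta>\<rbrakk> \<Longrightarrow> mdist m (u y) (u x) < \<epsilon> / 2"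
      using uc'[rule_format, OF half_gt_zero[OF \<open>\<epsilon> > 0\<close>]] by auto
    have "mdist (BC_plus m) (translate_plus \<tau> u) (translate_plus \<sigma> u) \<le> \<epsilon> / 2"
      if "\<sigma> \<ge> 0" "\<tau> \<ge> 0" "dist \<tau> \<sigma> < \<delta>" for \<sigma> \<tau>
    proof (subst mdist_BC_plus_le_iff)
      show "\<forall>t\<ge>0. mdist m (translate_plus \<tau> u t) (translate_plus \<sigma> u t) \<le> \<epsilon> / 2"
        using \<delta>(2)[of "t + \<sigma>" "t + \<tau>" for t] that
        by (auto simp: translate_plus_def intro!: less_imp_le)
    qed (use that u in \<open>auto intro: translate_plus_in_BC_plus\<close>)
    then show ?thesis
      using \<open>\<delta> > 0\<close> \<open>\<epsilon> > 0\<close> by (intro exI[of _ \<delta>]) fastforce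
  qed
  then show ?thesis
    using translate_plus_in_BC_plus[OF u]
    by (simp add: uniformly_continuous_map_def Pi_iff Ball_def)
qed

text \<open>The interval \<open>[0, t0 + \<omega>]\<close> already sweeps out the whole orbit: the transient plus one period.\<close>

lemma eventually_periodic_imp_compact_orbit:
  assumes u: "u \<in> mspace (BC_plus m)"
    and per: "\<And>t. t \<ge> t0 \<Longrightarrow> u (t + \<omega>) = u t" and "t0 \<ge> 0" "\<omega> > 0"
  shows "compactin (mtopology_of (BC_plus m)) {translate_plus \<tau> u |\<tau>. \<tau> \<ge> 0}"
proof -
  let ?T = "\<lambda>\<tau>. translate_plus \<tau> u"
  have "uniformly_continuous_map (submetric euclidean_metric {0..}) m u"
    using u per \<open>t0 \<ge> 0\<close> \<open>\<omega> > 0\<close>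
    by (intro eventually_periodic_imp_uniformly_continuous) (auto simp: mspace_BC_plus)
  from uniformly_continuous_translate_plus[OF u this]
  have "continuous_map (top_of_set {0..}) (mtopology_of (BC_plus m)) ?T"
    by (auto dest: uniformly_continuous_imp_continuous_map simp: mtopology_of_submetric)
  moreover have "compactin (top_of_set {0..}) {0..t0 + \<omega>}"
    by (auto simp: compactin_subtopology)
  ultimately have "compactin (mtopology_of (BC_plus m)) (?T ` {0..t0 + \<omega>})"
    by (rule image_compactin[rotated])
  moreover have "{?T \<tau> |\<tau>. \<tau> \<ge> 0} = ?T ` {0..t0 + \<omega>}"
  proof -
    have "?T \<tau> \<in> ?T ` {0..t0 + \<omega>}" if \<tau>: "\<tau> \<ge> t0" for \<tau>
    proof -
      obtain n s where n: "\<tau> = s + real n * \<omega>" "t0 \<le> s" "s < t0 + \<omega>"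
        using reduce_mod_period[OF \<open>\<omega> > 0\<close> \<tau>] by metis
      have "u (t + \<tau>) = u (t + s)" if "t \<ge> 0" for t
        using eventually_periodic_mult[of t0 u \<omega>, OF per \<open>\<omega> > 0\<close>, of "t + s" n] n that
        by (simp add: add_ac)
      then have "?T \<tau> = ?T s"
        by (auto simp: translate_plus_def)
      then show ?thesis
        using n \<open>t0 \<ge> 0\<close> by auto
    qed
    moreover have "?T \<tau> \<in> ?T ` {0..t0 + \<omega>}" if "0 \<le> \<tau>" "\<tau> < t0" for \<tau>
      using that \<open>\<omega> > 0\<close> by (intro imageI) auto
    ultimately have "?T \<tau> \<in> ?T ` {0..t0 + \<omega>}" if "\<tau> \<ge> 0" for \<tau>
      using that by (cases "\<tau> \<ge> t0") simp_all
    then show ?thesis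
      by auto
  qed
  ultimately show ?thesis
    by simp
qed

theorem corollary5p2:
  fixes m :: "'a metric" and u :: "real \<Rightarrow> 'a"
  assumes "mcomplete_of m"
    and "u \<in> mspace (BC_plus m)"
  shows "(\<exists>t0 \<omega>. t0 \<ge> 0 \<and> \<omega> > 0 \<and> (\<forall>t\<ge>t0. u (t + \<omega>) = u t)) \<longleftrightarrow>
         compactin (mtopology_of (BC_plus m)) {translate_plus \<tau> u |\<tau>. \<tau> \<ge> 0}"
proof
  assume "\<exists>t0 \<omega>. t0 \<ge> 0 \<and> \<omega> > 0 \<and> (\<forall>t\<ge>t0. u (t + \<omega>) = u t)"
  then show "compactin (mtopology_of (BC_plus m)) {translate_plus \<tau> u |\<tau>. \<tau> \<ge> 0}"
    using eventually_periodic_imp_compact_orbit[OF assms(2)] by blast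
next
  assume "compactin (mtopology_of (BC_plus m)) {translate_plus \<tau> u |\<tau>. \<tau> \<ge> 0}"
  then obtain \<sigma> \<tau> where "0 \<le> \<sigma>" "\<sigma> < \<tau>" "translate_plus \<sigma> u = translate_plus \<tau> u"
    using compact_orbit_imp_translate_plus_eq[OF assms(2)] by metis
  then have "0 \<le> \<sigma> \<and> 0 < \<tau> - \<sigma> \<and> (\<forall>t\<ge>\<sigma>. u (t + (\<tau> - \<sigma>)) = u t)"
    using translate_plus_eq_imp_periodic by auto
  then show "\<exists>t0 \<omega>. t0 \<ge> 0 \<and> \<omega> > 0 \<and> (\<forall>t\<ge>t0. u (t + \<omega>) = u t)"
    by blast
qed

end
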